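(* Let $G_1=(V_1,E_1)$ and $G_2=(V_2,E_2)$ be graphs on disjoint vertex sets, let $v\in V_1$, $w\in V_2$, and let $G=G_1\oplus_{v,w}G_2$ be their $1$-sum. Then \[ h^\ast(\mathcal{C}_G;z)=h^\ast(\mathcal{C}_{G_1};z)\cdot h^\ast(\mathcal{C}_{G_2};z). \]
   Context: A graph $G=(V,E)$ is a finite undirected graph with vertex set $V$ and a finite multiset $E$ of edges; multiple edges and loops are allowed, and $G$ has no isolated vertices. The $1$-sum $G_1\oplus_{v,w}G_2$ is the graph obtained from the disjoint union of $G_1$ and $G_2$ by identifying the vertices $v$ and $w$ into a single new vertex (edges incident to $v$ or $w$ become incident to the new vertex, multiplicities being kept). Let $\mathbb{R}^{V\cup E}$ have standard unit vectors $\mathbf{e}_\alpha$. The cosmological polytope of $G$ is $\mathcal{C}_G=\mathrm{conv}(\mathbf{e}_i+\mathbf{e}_j-\mathbf{e}_f,\ \mathbf{e}_i-\mathbf{e}_j+\mathbf{e}_f,\ -\mathbf{e}_i+\mathbf{e}_j+\mathbf{e}_f : f\in E \text{ with endpoints } i,j)\subset\mathbb{R}^{V\cup E}$ (for a loop, $i=j$), a lattice polytope of dimension $|V|+|E|-1$. For a $d$-dimensional lattice polytope $P\subset\mathbb{R}^N$, $h^\ast(P;z)$ is defined by $1+\sum_{t\ge1}|tP\cap\mathbb{Z}^N|z^t=h^\ast(P;z)/(1-z)^{d+1}$. *)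

theory Defs
  imports
    "HOL-Analysis.Analysis"
    "HOL-Analysis.Finite_Function_Topology"
    "HOL-Library.Uprod"
    "HOL-Computational_Algebra.Formal_Power_Series"
begin

section \<open>Multigraphs and 1-sums\<close>

text \<open>
  Edges are labelled, so distinct elements of \<open>edges G\<close> may have the same endpoints (a multiple
  edge), and \<open>Upair i i\<close> is the endpoint pair of a loop at \<open>i\<close>.
\<close>

record ('v, 'e) mgraph =
  verts :: "'v set"
  edges :: "'e set"
  ends :: "'e \<Rightarrow> 'v uprod"

text \<open>The last conjunct excludes isolated vertices; a vertex carrying a loop is not isolated.\<close>

definition multigraph :: "('v, 'e) mgraph \<Rightarrow> bool" where
  "multigraph G \<longleftrightarrow>
     finite (verts G) \<and> finite (edges G) \<and>
     (\<forall>f\<in>edges G. set_uprod (ends G f) \<subseteq> verts G) \<and>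
     (\<forall>u\<in>verts G. \<exists>f\<in>edges G. u \<in> set_uprod (ends G f))"

text \<open>
  In the 1-sum, \<open>None\<close> is the new vertex that replaces \<open>v\<close> and \<open>w\<close>. The definition is meant for
  graphs with disjoint vertex sets; the edge sets are made disjoint by the sum type.
\<close>

definition glue :: "'v \<Rightarrow> 'v \<Rightarrow> 'v \<Rightarrow> 'v option" where
  "glue v w u = (if u = v \<or> u = w then None else Some u)"

definition one_sum ::
  "('v, 'e) mgraph \<Rightarrow> 'v \<Rightarrow> 'v \<Rightarrow> ('v, 'f) mgraph \<Rightarrow> ('v option, 'e + 'f) mgraph" where
  "one_sum G1 v w G2 =
     \<lparr>verts = glue v w ` (verts G1 \<union> verts G2),
      edges = edges G1 <+> edges G2,
      ends = case_sum (map_uprod (glue v w) \<circ> ends G1) (map_uprod (glue v w) \<circ> ends G2)\<rparr>"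

lemma multigraph_one_sum:
  assumes "multigraph G1" and "multigraph G2"
  shows "multigraph (one_sum G1 v w G2)"
proof -
  have "\<exists>f\<in>edges G1 <+> edges G2. u \<in> set_uprod (ends (one_sum G1 v w G2) f)"
    if "u \<in> verts (one_sum G1 v w G2)" for u
  proof -
    from that obtain x where x: "x \<in> verts G1 \<union> verts G2" "u = glue v w x"
      by (auto simp: one_sum_def)
    then consider f where "f \<in> edges G1" "x \<in> set_uprod (ends G1 f)"
      | f where "f \<in> edges G2" "x \<in> set_uprod (ends G2 f)"
      using assms by (auto simp: multigraph_def)
    then show ?thesis
    proof cases
      case 1
      with x(2) show ?thesis
        by (intro bexI[of _ "Inl f"]) (auto simp: one_sum_def uprod.set_map)
    next
      case 2
      with x(2) show ?thesis
        by (intro bexI[of _ "Inr f"]) (auto simp: one_sum_def uprod.set_map)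
    qed
  qed
  moreover have "set_uprod (ends (one_sum G1 v w G2) f) \<subseteq> verts (one_sum G1 v w G2)"
    if "f \<in> edges G1 <+> edges G2" for f
    using that assms by (auto simp: multigraph_def one_sum_def uprod.set_map intro!: imageI; blast)
  ultimately show ?thesis
    using assms unfolding multigraph_def by (simp add: one_sum_def)
qed


section \<open>Cosmological polytopes\<close>

text \<open>
  \<open>\<real>\<^sup>V\<^sup>\<union>\<^sup>E\<close> is regarded as a coordinate subspace of the space of finitely supported functions
  \<open>'v + 'e \<Rightarrow>\<^sub>0 real\<close>: vertices index the left coordinates and edges the right ones. All
  coordinates outside \<open>V \<union> E\<close> vanish on the polytope, so neither its dimension nor the lattice
  points of its dilates depend on the ambient space.
\<close>

definition unit_vec :: "'a \<Rightarrow> 'a \<Rightarrow>\<^sub>0 real" where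
  "unit_vec a = Poly_Mapping.single a 1"

text \<open>
  As \<open>Upair i j = Upair j i\<close>, each edge is visited in both orientations below; the first
  set of generators is symmetric in \<open>i\<close> and \<open>j\<close>, and the other two are exchanged.
\<close>

definition cosmological_polytope :: "('v, 'e) mgraph \<Rightarrow> ('v + 'e \<Rightarrow>\<^sub>0 real) set" where
  "cosmological_polytope G = convex hull
     (\<Union>f\<in>edges G. \<Union>(i, j)\<in>{(i, j). ends G f = Upair i j}.
        {unit_vec (Inl i) + unit_vec (Inl j) - unit_vec (Inr f),
         unit_vec (Inl i) - unit_vec (Inl j) + unit_vec (Inr f),
         - unit_vec (Inl i) + unit_vec (Inl j) + unit_vec (Inr f)})"


section \<open>The $h^*$-polynomial\<close>

text \<open>
  The dimension of a nonempty set as that of the linear space parallel to its affine hull; the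
  library's \<open>aff_dim\<close> is restricted to Euclidean spaces.
\<close>

definition polytope_dim :: "'a::real_vector set \<Rightarrow> nat" where
  "polytope_dim P = dim {x - y | x y. x \<in> P \<and> y \<in> P}"

definition lattice_points :: "('a \<Rightarrow>\<^sub>0 real) set \<Rightarrow> ('a \<Rightarrow>\<^sub>0 real) set" where
  "lattice_points S = {x \<in> S. \<forall>a. Poly_Mapping.lookup x a \<in> \<int>}"

definition ehrhart_series :: "('a \<Rightarrow>\<^sub>0 real) set \<Rightarrow> int fps" where
  "ehrhart_series P =
     1 + Abs_fps (\<lambda>t. if t \<ge> 1 then int (card (lattice_points ((*\<^sub>R) (real t) ` P))) else 0)"

definition h_star :: "('a \<Rightarrow>\<^sub>0 real) set \<Rightarrow> int fps" where
  "h_star P = ehrhart_series P * (1 - fps_X) ^ (polytope_dim P + 1)"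

text \<open>
  The series \<open>h_star P\<close> is the unique solution \<open>h\<close> of \<open>ehrhart_series P = h / (1 - z) ^ (d + 1)\<close>,
  where \<open>1 / (1 - z)\<close> is the geometric series. For a lattice polytope it is a polynomial.
\<close>

lemma h_star_unique:
  "ehrhart_series P = h * Abs_fps (\<lambda>_. 1) ^ (polytope_dim P + 1) \<longleftrightarrow> h = h_star P"
proof -
  have "(1 - fps_X) * Abs_fps (\<lambda>_. 1) = (1 :: int fps)"
    by (rule fps_ext) (simp add: left_diff_distrib)
  then have "(1 - fps_X) ^ n * Abs_fps (\<lambda>_. 1) ^ n = (1 :: int fps)" for n
    by (simp flip: power_mult_distrib)
  then show ?thesis
    unfolding h_star_def by (auto simp: mult.assoc mult.commute[of "Abs_fps _ ^ _"] simp del: power_Suc)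
qed

end

theory Submission
  imports Defs
begin

text \<open>
  The cone \<open>K\<close> over the polytope of \<open>G\<close> is the image of the product of the cones \<open>K\<^sub>1\<close>, \<open>K\<^sub>2\<close> under
  adding the coordinates at \<open>v\<close> and \<open>w\<close>. By a description of \<open>K\<^sub>i\<close> through inequalities
  similar to the Gale--Hoffman conditions for feasible flows, the coordinate at \<open>v\<close> has coefficient
  0 or 1 in every inequality. So if the other coordinates are integral, the least admissible value
  at \<open>v\<close> is an integer. A lattice point of \<open>K\<close> that leaves \<open>K\<close> when the unit vector at the new
  vertex is subtracted is therefore uniquely a sum of two such points of \<open>K\<^sub>1\<close> and \<open>K\<^sub>2\<close>. The
  generating function of these points is \<open>(1 - z)\<close> times the Ehrhart series, so
  \<open>(1 - z) E(z) = (1 - z) E\<^sub>1(z) (1 - z) E\<^sub>2(z)\<close>, and the dimensions add.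
\<close>

section \<open>Linear maps on finitely supported functions\<close>

abbreviation coord :: "('a \<Rightarrow>\<^sub>0 real) \<Rightarrow> 'a \<Rightarrow> real" where
  "coord \<equiv> Poly_Mapping.lookup"

abbreviation supp :: "('a \<Rightarrow>\<^sub>0 real) \<Rightarrow> 'a set" where
  "supp \<equiv> Poly_Mapping.keys"

lemma coord_scaleR [simp]: "coord (c *\<^sub>R x) a = c * coord x a"
proof -
  have "{i. c * coord x i \<noteq> 0} \<subseteq> supp x"
    by (auto simp: in_keys_iff)
  then have "finite {i. c * coord x i \<noteq> 0}"
    using finite_keys finite_subset by blast
  then show ?thesis
    by (simp add: scaleR_poly_mapping_def)
qed

lemma coord_unit_vec: "coord (unit_vec a) b = (if a = b then 1 else 0)"
  by (simp add: unit_vec_def lookup_single when_def)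

lemma supp_unit_vec [simp]: "supp (unit_vec a) = {a}"
  by (simp add: unit_vec_def)

lemmas coord_simps = lookup_add lookup_minus coord_unit_vec

definition lin_ext :: "('a \<Rightarrow> 'b::real_vector) \<Rightarrow> ('a \<Rightarrow>\<^sub>0 real) \<Rightarrow> 'b" where
  "lin_ext f x = (\<Sum>a\<in>supp x. coord x a *\<^sub>R f a)"

lemma lin_ext_eq_sum:
  assumes "finite A" "supp x \<subseteq> A"
  shows "lin_ext f x = (\<Sum>a\<in>A. coord x a *\<^sub>R f a)"
  unfolding lin_ext_def using assms
  by (intro sum.mono_neutral_left) (auto simp: in_keys_iff)

lemma linear_lin_ext: "linear (lin_ext f)"
proof (rule linearI)
  fix x y :: "'a \<Rightarrow>\<^sub>0 real" and c :: real
  have "finite (supp x \<union> supp y)" by simp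
  moreover have "supp (x + y) \<subseteq> supp x \<union> supp y" by (rule keys_add)
  ultimately show "lin_ext f (x + y) = lin_ext f x + lin_ext f y"
    by (simp add: lin_ext_eq_sum[of "supp x \<union> supp y"] lookup_add scaleR_add_left sum.distrib)
  have "supp (c *\<^sub>R x) \<subseteq> supp x" by (auto simp: in_keys_iff)
  then show "lin_ext f (c *\<^sub>R x) = c *\<^sub>R lin_ext f x"
    by (simp add: lin_ext_eq_sum[of "supp x"] scaleR_sum_right)
qed

lemma lin_ext_unit_vec [simp]: "lin_ext f (unit_vec a) = f a"
  by (simp add: lin_ext_def coord_unit_vec)

lemmas lin_ext_simps =
  linear_add[OF linear_lin_ext] linear_diff[OF linear_lin_ext] linear_neg[OF linear_lin_ext]
  linear_cmul[OF linear_lin_ext] linear_0[OF linear_lin_ext]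

lemma lin_ext_unit_vec_id: "lin_ext unit_vec x = x"
  by (rule poly_mapping_eqI)
    (auto simp: lin_ext_def lookup_sum coord_unit_vec in_keys_iff if_distrib cong: if_cong)

text \<open>The grading: every generator of a cosmological polytope has coordinate sum 1, so on the
  cone this functional reads off the dilation factor.\<close>

definition coord_sum :: "('a \<Rightarrow>\<^sub>0 real) \<Rightarrow> real" where
  "coord_sum = lin_ext (\<lambda>_. 1)"

lemma linear_coord_sum: "linear coord_sum"
  by (simp add: coord_sum_def linear_lin_ext)

lemma coord_sum_simps [simp]:
  "coord_sum (x + y) = coord_sum x + coord_sum y"
  "coord_sum (x - y) = coord_sum x - coord_sum y"
  "coord_sum (- x) = - coord_sum x"
  "coord_sum (c *\<^sub>R x) = c * coord_sum x"
  "coord_sum 0 = 0"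
  "coord_sum (unit_vec a) = 1"
  by (simp_all add: coord_sum_def lin_ext_simps)

text \<open>Push-forward along \<open>\<alpha>\<close>: coordinates with the same image are added,
  which is how identifying vertices acts on the cone.\<close>

definition relabel :: "('a \<Rightarrow> 'b) \<Rightarrow> ('a \<Rightarrow>\<^sub>0 real) \<Rightarrow> ('b \<Rightarrow>\<^sub>0 real)" where
  "relabel \<alpha> = lin_ext (\<lambda>a. unit_vec (\<alpha> a))"

lemma linear_relabel: "linear (relabel \<alpha>)"
  by (simp add: relabel_def linear_lin_ext)

lemma relabel_simps [simp]:
  "relabel \<alpha> (x + y) = relabel \<alpha> x + relabel \<alpha> y"
  "relabel \<alpha> (x - y) = relabel \<alpha> x - relabel \<alpha> y"
  "relabel \<alpha> (- x) = - relabel \<alpha> x"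
  "relabel \<alpha> (c *\<^sub>R x) = c *\<^sub>R relabel \<alpha> x"
  "relabel \<alpha> (unit_vec a) = unit_vec (\<alpha> a)"
  by (simp_all add: relabel_def lin_ext_simps)

lemma coord_sum_relabel [simp]: "coord_sum (relabel \<alpha> x) = coord_sum x"
proof -
  have "coord_sum (relabel \<alpha> x) = (\<Sum>a\<in>supp x. coord_sum (coord x a *\<^sub>R unit_vec (\<alpha> a)))"
    by (simp only: relabel_def lin_ext_def linear_sum[OF linear_coord_sum])
  then show ?thesis
    unfolding coord_sum_simps by (simp add: coord_sum_def lin_ext_def)
qed

lemma coord_relabel:
  assumes "inj_on \<alpha> A" "supp x \<subseteq> A" "a \<in> A"
  shows "coord (relabel \<alpha> x) (\<alpha> a) = coord x a"
proof -
  have "coord (relabel \<alpha> x) (\<alpha> a) = (\<Sum>b\<in>supp x. coord x b * (if \<alpha> b = \<alpha> a then 1 else 0))"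
    by (simp add: relabel_def lin_ext_def lookup_sum coord_unit_vec)
  also have "\<dots> = (\<Sum>b\<in>supp x. if b = a then coord x b else 0)"
    using assms by (intro sum.cong) (auto simp: inj_on_def)
  also have "\<dots> = coord x a"
    by (auto simp: in_keys_iff)
  finally show ?thesis .
qed

lemma coord_relabel_notin:
  assumes "supp x \<subseteq> A" "b \<notin> \<alpha> ` A"
  shows "coord (relabel \<alpha> x) b = 0"
proof -
  have "\<alpha> a \<noteq> b" if "a \<in> supp x" for a
    using assms that by blast
  then show ?thesis
    by (auto simp: relabel_def lin_ext_def lookup_sum coord_unit_vec intro!: sum.neutral)
qed

lemma coord_relabel_Ints:
  assumes "\<And>a. coord x a \<in> \<int>"
  shows "coord (relabel \<alpha> x) b \<in> \<int>"
  using assms by (auto simp: relabel_def lin_ext_def lookup_sum coord_unit_vec intro!: Ints_sum Ints_mult)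

definition integral_points :: "('a \<Rightarrow>\<^sub>0 real) set \<Rightarrow> nat \<Rightarrow> ('a \<Rightarrow>\<^sub>0 real) set" where
  "integral_points K t = {x \<in> K. (\<forall>a. coord x a \<in> \<int>) \<and> coord_sum x = real t}"

text \<open>Bottom ends of the lattice lines in direction \<open>v\<close>: in a
  \<open>floor_cone\<close>, every lattice point is one of these plus a natural multiple of
  \<open>unit_vec v\<close>, in a unique way.\<close>

definition lowest_points :: "('a \<Rightarrow>\<^sub>0 real) set \<Rightarrow> 'a \<Rightarrow> nat \<Rightarrow> ('a \<Rightarrow>\<^sub>0 real) set" where
  "lowest_points K v t = {x \<in> integral_points K t. x - unit_vec v \<notin> K}"

section \<open>Counting the lattice points of a glued cone\<close>

text \<open>The decisive property is \<open>floor_mem\<close>: once the other coordinates are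
  integral, the least admissible value at \<open>v\<close> is an integer. The remaining ones keep
  the counts finite, let the coordinate at \<open>v\<close> grow freely and confine \<open>K\<close>
  to the index set \<open>A\<close>.\<close>

locale floor_cone =
  fixes K :: "('a \<Rightarrow>\<^sub>0 real) set" and v :: 'a and A :: "'a set"
  assumes cone: "convex_cone K"
    and supp_subset: "x \<in> K \<Longrightarrow> supp x \<subseteq> A"
    and coord_sum_nonneg: "x \<in> K \<Longrightarrow> 0 \<le> coord_sum x"
    and finite_integral_points: "finite (integral_points K t)"
    and unit_vec_mem: "unit_vec v \<in> K"
    and floor_mem: "x \<in> K \<Longrightarrow> (\<And>a. a \<noteq> v \<Longrightarrow> coord x a \<in> \<int>) \<Longrightarrow>
      x - frac (coord x v) *\<^sub>R unit_vec v \<in> K"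
begin

lemma add_unit_vec: "x \<in> K \<Longrightarrow> 0 \<le> r \<Longrightarrow> x + r *\<^sub>R unit_vec v \<in> K"
  using cone unit_vec_mem by (intro convex_cone_add convex_cone_scaleR)

lemma finite_lowest_points: "finite (lowest_points K v t)"
  unfolding lowest_points_def using finite_integral_points by simp

text \<open>Lowest points are defined by integer steps; this excludes real steps down as well. For
  negative \<open>r\<close>, rounding down the coordinate at \<open>v\<close> keeps \<open>x\<close>
  shifted by \<open>\<lfloor>r\<rfloor> \<le> - 1\<close> in \<open>K\<close>, and moving up from
  there reaches \<open>x - unit_vec v\<close>.\<close>

lemma lowest_coord_le:
  assumes "x \<in> lowest_points K v t" "x + r *\<^sub>R unit_vec v \<in> K"
  shows "0 \<le> r"
proof (rule ccontr)
  assume "\<not> 0 \<le> r"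
  have int: "\<And>a. coord x a \<in> \<int>" and notin: "x - unit_vec v \<notin> K"
    using assms(1) by (auto simp: lowest_points_def integral_points_def)
  define y where "y = x + r *\<^sub>R unit_vec v"
  have "y - frac (coord y v) *\<^sub>R unit_vec v \<in> K"
    using assms(2) int by (intro floor_mem) (auto simp: y_def coord_simps)
  moreover have frac: "frac (coord y v) = r - of_int \<lfloor>r\<rfloor>"
    using int[of v] by (auto simp: y_def coord_simps frac_def elim!: Ints_cases)
  ultimately have "x + of_int \<lfloor>r\<rfloor> *\<^sub>R unit_vec v \<in> K"
    unfolding frac by (simp add: y_def algebra_simps)
  moreover have "0 \<le> - 1 - real_of_int \<lfloor>r\<rfloor>"
  proof -
    have "\<lfloor>r\<rfloor> \<le> - 1"
      using \<open>\<not> 0 \<le> r\<close> by linarith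
    then show ?thesis by linarith
  qed
  ultimately have "x + of_int \<lfloor>r\<rfloor> *\<^sub>R unit_vec v + (- 1 - real_of_int \<lfloor>r\<rfloor>) *\<^sub>R unit_vec v \<in> K"
    by (rule add_unit_vec)
  with notin show False
    by (simp add: algebra_simps)
qed

text \<open>Translation by \<open>unit_vec v\<close> is injective and raises the height by one. The
  points of height \<open>t\<close> that it misses are exactly the lowest ones.\<close>

lemma lowest_points_gf:
  "(1 - fps_X) * Abs_fps (\<lambda>t. int (card (integral_points K t))) =
   Abs_fps (\<lambda>t. int (card (lowest_points K v t)))"
proof (rule fps_ext)
  fix t
  show "fps_nth ((1 - fps_X) * Abs_fps (\<lambda>t. int (card (integral_points K t)))) t =
    fps_nth (Abs_fps (\<lambda>t. int (card (lowest_points K v t)))) t"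
  proof (cases t)
    case 0
    \<comment> \<open>At height 0 every point is lowest, since a step down would make the coordinate
      sum negative.\<close>
    have "lowest_points K v 0 = integral_points K 0"
      using coord_sum_nonneg by (force simp: lowest_points_def integral_points_def)
    then show ?thesis
      by (simp add: 0 left_diff_distrib)
  next
    case (Suc s)
    have "integral_points K t = lowest_points K v t \<union> (\<lambda>x. x + unit_vec v) ` integral_points K s"
    proof (intro equalityI subsetI)
      fix x assume x: "x \<in> integral_points K t"
      show "x \<in> lowest_points K v t \<union> (\<lambda>x. x + unit_vec v) ` integral_points K s"
      proof (cases "x - unit_vec v \<in> K")
        case True
        then have "x - unit_vec v \<in> integral_points K s"
          using x Suc by (auto simp: integral_points_def coord_simps)
        then show ?thesis
          by (intro UnI2 image_eqI[of _ _ "x - unit_vec v"]) auto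
      qed (use x in \<open>auto simp: lowest_points_def\<close>)
    next
      fix x assume "x \<in> lowest_points K v t \<union> (\<lambda>x. x + unit_vec v) ` integral_points K s"
      then show "x \<in> integral_points K t"
        using Suc add_unit_vec[where r = 1]
        by (auto simp: lowest_points_def integral_points_def coord_simps)
    qed
    moreover have "lowest_points K v t \<inter> (\<lambda>x. x + unit_vec v) ` integral_points K s = {}"
      by (auto simp: lowest_points_def integral_points_def)
    ultimately have "card (integral_points K t) =
        card (lowest_points K v t) + card ((\<lambda>x. x + unit_vec v) ` integral_points K s)"
      using finite_integral_points finite_lowest_points by (simp add: card_Un_disjoint)
    also have "card ((\<lambda>x. x + unit_vec v) ` integral_points K s) = card (integral_points K s)"
      by (intro card_image) (auto simp: inj_on_def)
    finally show ?thesis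
      using Suc by (simp add: left_diff_distrib)
  qed
qed

end

text \<open>Injectivity is required only on the index sets \<open>A\<close> and \<open>B\<close>:
  the gluing map of a 1-sum collapses \<open>v\<close> and \<open>w\<close>, but each summand
  contains just one of them.\<close>

locale glued_floor_cones = L: floor_cone K1 v A + R: floor_cone K2 w B
  for K1 :: "('a \<Rightarrow>\<^sub>0 real) set" and v A
    and K2 :: "('b \<Rightarrow>\<^sub>0 real) set" and w B +
  fixes \<alpha> :: "'a \<Rightarrow> 'c" and \<beta> :: "'b \<Rightarrow> 'c" and K :: "('c \<Rightarrow>\<^sub>0 real) set"
  assumes inj: "inj_on \<alpha> A" "inj_on \<beta> B"
    and overlap: "\<alpha> ` A \<inter> \<beta> ` B = {\<alpha> v}" and apex: "\<beta> w = \<alpha> v"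
    and K_eq: "K = (\<Union>x\<in>K1. \<Union>y\<in>K2. {relabel \<alpha> x + relabel \<beta> y})"
begin

section \<open>Coordinates and splittings of points of the glued cone\<close>

lemma v_in: "v \<in> A" and w_in: "w \<in> B"
  using L.supp_subset[OF L.unit_vec_mem] R.supp_subset[OF R.unit_vec_mem] by auto

lemma coord_left:
  assumes "x \<in> K1" "y \<in> K2" "a \<in> A" "a \<noteq> v"
  shows "coord (relabel \<alpha> x + relabel \<beta> y) (\<alpha> a) = coord x a"
proof -
  have "\<alpha> a \<noteq> \<alpha> v"
    using inj(1) assms(3,4) v_in by (auto simp: inj_on_def)
  then have "\<alpha> a \<notin> \<beta> ` B"
    using overlap assms(3) by blast
  then show ?thesis
    using assms L.supp_subset R.supp_subset inj
    by (simp add: lookup_add coord_relabel[of _ A] coord_relabel_notin[of _ B])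
qed

lemma coord_right:
  assumes "x \<in> K1" "y \<in> K2" "b \<in> B" "b \<noteq> w"
  shows "coord (relabel \<alpha> x + relabel \<beta> y) (\<beta> b) = coord y b"
proof -
  have "\<beta> b \<noteq> \<beta> w"
    using inj(2) assms(3,4) w_in by (auto simp: inj_on_def)
  then have "\<beta> b \<notin> \<alpha> ` A"
    using overlap apex assms(3) by auto
  then show ?thesis
    using assms L.supp_subset R.supp_subset inj
    by (simp add: lookup_add coord_relabel[of _ B] coord_relabel_notin[of _ A])
qed

lemma coord_apex:
  assumes "x \<in> K1" "y \<in> K2"
  shows "coord (relabel \<alpha> x + relabel \<beta> y) (\<alpha> v) = coord x v + coord y w"
  using coord_relabel[OF inj(1) L.supp_subset[OF assms(1)] v_in]
    coord_relabel[OF inj(2) R.supp_subset[OF assms(2)] w_in]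
  by (simp add: lookup_add apex)

text \<open>Away from the apex each coordinate of a sum comes from a single summand, so two
  splittings differ only by multiples of the unit vectors at \<open>v\<close> and \<open>w\<close>.
  The shift \<open>s\<close> covers both a step down at the apex (\<open>s = - 1\<close>) and
  equality (\<open>s = 0\<close>).\<close>

lemma splitting_unique:
  assumes "x \<in> K1" "y \<in> K2" "x' \<in> K1" "y' \<in> K2"
    and eq: "relabel \<alpha> x' + relabel \<beta> y' = relabel \<alpha> x + relabel \<beta> y + s *\<^sub>R unit_vec (\<alpha> v)"
  obtains r where "x' = x + r *\<^sub>R unit_vec v" "y' = y + (s - r) *\<^sub>R unit_vec w"
proof
  define r where "r = coord x' v - coord x v"
  note eq' = arg_cong[OF eq, of "\<lambda>z. coord z c" for c]
  have neq: "\<alpha> a \<noteq> \<alpha> v" if "a \<in> A" "a \<noteq> v" for a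
    using that inj(1) v_in by (auto simp: inj_on_def)
  have neq': "\<beta> b \<noteq> \<alpha> v" if "b \<in> B" "b \<noteq> w" for b
    using that inj(2) w_in unfolding apex[symmetric] by (auto simp: inj_on_def)
  show "x' = x + r *\<^sub>R unit_vec v"
  proof (rule poly_mapping_eqI)
    fix a
    consider "a = v" | "a \<in> A" "a \<noteq> v" | "a \<notin> A" "a \<noteq> v" by blast
    then show "coord x' a = coord (x + r *\<^sub>R unit_vec v) a"
    proof cases
      case 2
      then show ?thesis
        using eq'[of "\<alpha> a"] assms(1-4) neq[of a]
        by (simp add: coord_left lookup_add[of "_ + _"] coord_unit_vec) (simp add: coord_simps)
    next
      case 3
      then have "a \<notin> supp x" "a \<notin> supp x'"
        using assms(1,3) L.supp_subset by blast+
      then show ?thesis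
        using 3 by (simp add: coord_simps in_keys_iff)
    qed (simp add: r_def coord_simps)
  qed
  show "y' = y + (s - r) *\<^sub>R unit_vec w"
  proof (rule poly_mapping_eqI)
    fix b
    consider "b = w" | "b \<in> B" "b \<noteq> w" | "b \<notin> B" "b \<noteq> w" by blast
    then show "coord y' b = coord (y + (s - r) *\<^sub>R unit_vec w) b"
    proof cases
      case 1
      then show ?thesis
        using eq'[of "\<alpha> v"] assms(1-4)
        by (simp add: coord_apex lookup_add[of "_ + _"] coord_unit_vec)
          (simp add: coord_simps r_def)
    next
      case 2
      then show ?thesis
        using eq'[of "\<beta> b"] assms(1-4) neq'[of b]
        by (simp add: coord_right lookup_add[of "_ + _"] coord_unit_vec) (auto simp add: coord_simps)
    next
      case 3
      then have "b \<notin> supp y" "b \<notin> supp y'"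
        using assms(2,4) R.supp_subset by blast+
      then show ?thesis
        using 3 by (simp add: coord_simps in_keys_iff)
    qed
  qed
qed

text \<open>A step down of the sum would shift the summands by \<open>r\<close> and
  \<open>- 1 - r\<close>, which cannot both be nonnegative. As the points of \<open>K1\<close> and
  \<open>K2\<close> in that splitting need not be integral, \<open>r\<close> is real and
  \<open>lowest_coord_le\<close> is essential.\<close>

lemma lowest_points_sum:
  assumes x: "x \<in> lowest_points K1 v k" and y: "y \<in> lowest_points K2 w l"
  shows "relabel \<alpha> x + relabel \<beta> y \<in> lowest_points K (\<alpha> v) (k + l)"
proof -
  have mem: "x \<in> K1" "y \<in> K2"
    using x y by (auto simp: lowest_points_def integral_points_def)
  have "relabel \<alpha> x + relabel \<beta> y \<in> integral_points K (k + l)"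
    using x y coord_relabel_Ints[of x \<alpha>] coord_relabel_Ints[of y \<beta>]
    by (auto simp: lowest_points_def integral_points_def K_eq lookup_add)
  moreover have "relabel \<alpha> x + relabel \<beta> y - unit_vec (\<alpha> v) \<notin> K"
  proof
    assume "relabel \<alpha> x + relabel \<beta> y - unit_vec (\<alpha> v) \<in> K"
    then obtain x' y' where mem': "x' \<in> K1" "y' \<in> K2" and
      "relabel \<alpha> x' + relabel \<beta> y' = relabel \<alpha> x + relabel \<beta> y + (- 1) *\<^sub>R unit_vec (\<alpha> v)"
      by (auto simp: K_eq)
    from splitting_unique[OF mem mem' this(3)] obtain r where
      r: "x' = x + r *\<^sub>R unit_vec v" "y' = y + (- 1 - r) *\<^sub>R unit_vec w" .
    have "0 \<le> r" "0 \<le> - 1 - r"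
      using L.lowest_coord_le[OF x] R.lowest_coord_le[OF y] mem' unfolding r by blast+
    then show False by simp
  qed
  ultimately show ?thesis
    by (simp add: lowest_points_def)
qed

text \<open>Here the shifts are \<open>r\<close> and \<open>- r\<close>; both are nonnegative, hence
  zero.\<close>

lemma lowest_points_splitting_unique:
  assumes x: "x \<in> lowest_points K1 v k" and y: "y \<in> lowest_points K2 w l"
    and x': "x' \<in> lowest_points K1 v k'" and y': "y' \<in> lowest_points K2 w l'"
    and eq: "relabel \<alpha> x' + relabel \<beta> y' = relabel \<alpha> x + relabel \<beta> y"
  shows "x' = x" "y' = y"
proof -
  have mem: "x \<in> K1" "y \<in> K2" "x' \<in> K1" "y' \<in> K2"
    using x y x' y' by (auto simp: lowest_points_def integral_points_def)
  obtain r where r: "x' = x + r *\<^sub>R unit_vec v" "y' = y + (0 - r) *\<^sub>R unit_vec w"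
    using splitting_unique[OF mem, of 0] eq by auto
  have "0 \<le> r" "0 \<le> 0 - r"
    using L.lowest_coord_le[OF x] R.lowest_coord_le[OF y] mem(3,4) unfolding r by blast+
  then show "x' = x" "y' = y"
    using r by auto
qed

lemma lowest_points_split:
  assumes z: "z \<in> lowest_points K (\<alpha> v) t"
  obtains k x y where "k \<le> t" "x \<in> lowest_points K1 v k" "y \<in> lowest_points K2 w (t - k)"
    "z = relabel \<alpha> x + relabel \<beta> y"
proof -
  have int: "\<And>c. coord z c \<in> \<int>" and sum: "coord_sum z = real t"
    and notin: "z - unit_vec (\<alpha> v) \<notin> K" and "z \<in> K"
    using z by (auto simp: lowest_points_def integral_points_def)
  then obtain x' y' where mem': "x' \<in> K1" "y' \<in> K2" and z_eq': "z = relabel \<alpha> x' + relabel \<beta> y'"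
    by (auto simp: K_eq)
  \<comment> \<open>The fractional part at \<open>v\<close> moves over to \<open>w\<close>. Both
    unit vectors have the same image, so the sum stays \<open>z\<close>; \<open>floor_mem\<close>
    keeps \<open>x\<close> in \<open>K1\<close>, and \<open>y\<close> only moves up.\<close>
  define q where "q = frac (coord x' v)"
  define x where "x = x' - q *\<^sub>R unit_vec v"
  define y where "y = y' + q *\<^sub>R unit_vec w"
  have int': "coord x' a \<in> \<int>" if "a \<noteq> v" for a
  proof (cases "a \<in> A")
    case True
    then show ?thesis
      using coord_left[OF mem', of a] int[of "\<alpha> a"] that z_eq' by simp
  next
    case False
    then have "a \<notin> supp x'" using L.supp_subset[OF mem'(1)] by blast
    then show ?thesis by (simp add: in_keys_iff)
  qed
  have x: "x \<in> K1"
    unfolding x_def q_def using mem'(1) int' by (rule L.floor_mem)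
  have y: "y \<in> K2"
    unfolding y_def q_def using mem'(2) by (intro R.add_unit_vec) auto
  have z_eq: "z = relabel \<alpha> x + relabel \<beta> y"
    by (simp add: x_def y_def z_eq' apex)
  have int_x: "coord x a \<in> \<int>" for a
    using int'[of a] by (auto simp: x_def q_def coord_simps frac_def)
  have int_y: "coord y b \<in> \<int>" for b
  proof (cases "b \<in> B")
    case True
    \<comment> \<open>Integrality at \<open>w\<close> follows from that of \<open>z\<close> and
      \<open>x\<close> at the apex.\<close>
    have "coord y w = coord z (\<alpha> v) - coord x v"
      using coord_apex[OF x y] by (simp add: z_eq)
    then have "coord y w \<in> \<int>"
      using int int_x by simp
    then show ?thesis
      using coord_right[OF x y True] int[of "\<beta> b"] z_eq by (cases "b = w") auto
  next
    case False
    then have "b \<notin> supp y" using R.supp_subset[OF y] by blast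
    then show ?thesis by (simp add: in_keys_iff)
  qed
  have sum_int: "coord_sum u \<in> \<int>" if "\<And>a. coord u a \<in> \<int>" for u :: "'d \<Rightarrow>\<^sub>0 real"
    using that by (auto simp: coord_sum_def lin_ext_def intro: Ints_sum)
  obtain k where k: "coord_sum x = real k"
    using sum_int[OF int_x] L.coord_sum_nonneg[OF x] by (metis Ints_cases of_int_0_le_iff of_int_of_nat_eq zero_le_imp_eq_int)
  have l: "coord_sum y = real t - real k"
    using sum z_eq k by simp
  have kt: "k \<le> t"
    using R.coord_sum_nonneg[OF y] l by simp
  \<comment> \<open>A step down in either summand would be a step down of \<open>z\<close>.\<close>
  have "x - unit_vec v \<notin> K1"
  proof
    assume "x - unit_vec v \<in> K1"
    then have "relabel \<alpha> (x - unit_vec v) + relabel \<beta> y \<in> K"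
      using y unfolding K_eq by blast
    then show False using notin by (simp add: z_eq algebra_simps)
  qed
  moreover have "y - unit_vec w \<notin> K2"
  proof
    assume "y - unit_vec w \<in> K2"
    then have "relabel \<alpha> x + relabel \<beta> (y - unit_vec w) \<in> K"
      using x unfolding K_eq by blast
    then show False using notin by (simp add: z_eq apex algebra_simps)
  qed
  ultimately show ?thesis
    using x y int_x int_y k l kt z_eq
    by (intro that[of k x y]) (auto simp: lowest_points_def integral_points_def of_nat_diff)
qed

lemma card_lowest_points:
  "card (lowest_points K (\<alpha> v) t) =
   (\<Sum>k=0..t. card (lowest_points K1 v k) * card (lowest_points K2 w (t - k)))"
proof -
  let ?S = "SIGMA k:{0..t}. lowest_points K1 v k \<times> lowest_points K2 w (t - k)"
  let ?f = "\<lambda>(k::nat, x, y). relabel \<alpha> x + relabel \<beta> y"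
  have inj_f: "inj_on ?f ?S"
  proof (rule inj_onI)
    fix p p' assume p: "p \<in> ?S" "p' \<in> ?S" "?f p = ?f p'"
    obtain k x y k' x' y' where [simp]: "p = (k, x, y)" "p' = (k', x', y')"
      by (metis prod.exhaust)
    have "x = x'" "y = y'"
      using p lowest_points_splitting_unique[of x' k' y' "t - k'" x k y "t - k"] by simp_all
    \<comment> \<open>The index is recovered from the first summand as its coordinate sum.\<close>
    moreover have "real k = real k'"
      using p \<open>x = x'\<close> by (simp add: lowest_points_def integral_points_def)
    ultimately show "p = p'"
      by simp
  qed
  have image_f: "?f ` ?S = lowest_points K (\<alpha> v) t"
  proof (intro equalityI subsetI)
    fix z assume "z \<in> lowest_points K (\<alpha> v) t"
    then obtain k x y where "k \<le> t" "x \<in> lowest_points K1 v k" "y \<in> lowest_points K2 w (t - k)"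
      "z = relabel \<alpha> x + relabel \<beta> y"
      by (rule lowest_points_split)
    then show "z \<in> ?f ` ?S"
      by (intro image_eqI[of _ _ "(k, x, y)"]) auto
  next
    fix z assume "z \<in> ?f ` ?S"
    then obtain k x y where "k \<le> t" "x \<in> lowest_points K1 v k" "y \<in> lowest_points K2 w (t - k)"
      "z = relabel \<alpha> x + relabel \<beta> y"
      by auto
    then show "z \<in> lowest_points K (\<alpha> v) t"
      using lowest_points_sum[of x k y "t - k"] by simp
  qed
  have "card (lowest_points K (\<alpha> v) t) = card ?S"
    using card_image[OF inj_f] unfolding image_f .
  also have "\<dots> = (\<Sum>k=0..t. card (lowest_points K1 v k) * card (lowest_points K2 w (t - k)))"
    using L.finite_lowest_points R.finite_lowest_points
    by (subst card_SigmaI) (auto simp: card_cartesian_product)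
  finally show ?thesis .
qed

end

section \<open>Inequalities for the cosmological cone\<close>

definition cut_weight :: "real \<Rightarrow> 'v uprod \<Rightarrow> 'v set \<Rightarrow> real" where
  "cut_weight r u S =
     (if set_uprod u \<inter> S = {} then 0 else if set_uprod u \<subseteq> S then min 0 (2 * r) else r)"

text \<open>
  Write a cone element as a sum over edges \<open>f = ij\<close> of vectors \<open>p e\<^sub>i + q e\<^sub>j + r e\<^sub>f\<close> with
  \<open>p + q, p + r, q + r \<ge> 0\<close>. The least possible share of \<open>f\<close> in the vertex sum over \<open>S\<close> is
  \<open>max 0 (- 2 * r)\<close> if both ends are in \<open>S\<close> and \<open>- r\<close> if one is; \<open>cut_weight\<close> is its negative.
\<close>

definition cut_form :: "('e \<Rightarrow> 'v uprod) \<Rightarrow> 'e set \<Rightarrow> ('v + 'e \<Rightarrow>\<^sub>0 real) \<Rightarrow> 'v set \<Rightarrow> real" where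
  "cut_form \<epsilon> F x S = (\<Sum>i\<in>S. coord x (Inl i)) + (\<Sum>f\<in>F. cut_weight (coord x (Inr f)) (\<epsilon> f) S)"

text \<open>Equality holds unless \<open>S\<close> contains just one end of the edge and
  \<open>T\<close> just the other; then the claim is
  \<open>min 0 (2 * r) \<le> 2 * r\<close>.\<close>

lemma cut_weight_submodular:
  "cut_weight r u (S \<inter> T) + cut_weight r u (S \<union> T) \<le> cut_weight r u S + cut_weight r u T"
  by (cases u) (auto simp: cut_weight_def)

lemma cut_weight_0 [simp]: "cut_weight 0 u S = 0"
  by (simp add: cut_weight_def)

lemma cut_weight_add: "cut_weight r u S + cut_weight s u S \<le> cut_weight (r + s) u S"
  by (auto simp: cut_weight_def)

lemma cut_weight_scale: "0 \<le> c \<Longrightarrow> cut_weight (c * r) u S = c * cut_weight r u S"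
  by (auto simp: cut_weight_def min_def mult_le_0_iff zero_le_mult_iff not_le split: if_splits)

lemma cut_weight_Ints: "r \<in> \<int> \<Longrightarrow> cut_weight r u S \<in> \<int>"
  by (auto simp: cut_weight_def min_def)

lemma cut_form_submodular:
  assumes "finite S" "finite T"
  shows "cut_form \<epsilon> F x (S \<inter> T) + cut_form \<epsilon> F x (S \<union> T) \<le> cut_form \<epsilon> F x S + cut_form \<epsilon> F x T"
proof -
  have "(\<Sum>f\<in>F. cut_weight (coord x (Inr f)) (\<epsilon> f) (S \<inter> T)) +
      (\<Sum>f\<in>F. cut_weight (coord x (Inr f)) (\<epsilon> f) (S \<union> T)) \<le>
      (\<Sum>f\<in>F. cut_weight (coord x (Inr f)) (\<epsilon> f) S) +
      (\<Sum>f\<in>F. cut_weight (coord x (Inr f)) (\<epsilon> f) T)"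
    by (simp only: sum.distrib[symmetric]) (intro sum_mono cut_weight_submodular)
  then show ?thesis
    using sum.union_inter[OF assms, of "\<lambda>i. coord x (Inl i)"] by (simp add: cut_form_def)
qed

definition edge_vectors :: "'v \<Rightarrow> 'v \<Rightarrow> 'e \<Rightarrow> ('v + 'e \<Rightarrow>\<^sub>0 real) set" where
  "edge_vectors i j f =
    {unit_vec (Inl i) + unit_vec (Inl j) - unit_vec (Inr f),
     unit_vec (Inl i) - unit_vec (Inl j) + unit_vec (Inr f),
     - unit_vec (Inl i) + unit_vec (Inl j) + unit_vec (Inr f)}"

lemma sum_coord_unit_vec:
  assumes "finite S"
  shows "(\<Sum>i\<in>S. coord (unit_vec (Inl k)) (Inl i)) = of_bool (k \<in> S)"
    "(\<Sum>i\<in>S. coord (unit_vec (Inr f)) (Inl i)) = 0"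
  using assms by (simp_all add: coord_unit_vec)

text \<open>
  Induction on the edges. If \<open>r \<ge> 0\<close> and \<open>i \<noteq> j\<close>, the edge takes a share \<open>q\<close> at \<open>i\<close> and \<open>- q\<close> at \<open>j\<close>.
  The conditions on \<open>q\<close> are lower and upper bounds, and submodularity of \<open>cut_form\<close>
  makes every lower bound at most every upper bound.
\<close>

lemma mem_cone_if_cut_form_nonneg:
  fixes K :: "('v + 'e \<Rightarrow>\<^sub>0 real) set"
  assumes K: "convex_cone K" and V: "finite V" and "finite F"
    and unit: "\<And>i. i \<in> V \<Longrightarrow> unit_vec (Inl i) \<in> K"
    and ends: "\<And>f. f \<in> F \<Longrightarrow> set_uprod (\<epsilon> f) \<subseteq> V"
    and vecs: "\<And>f i j. f \<in> F \<Longrightarrow> \<epsilon> f = Upair i j \<Longrightarrow> edge_vectors i j f \<subseteq> K"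
    and "supp x \<subseteq> V <+> F" and "\<And>S. S \<subseteq> V \<Longrightarrow> 0 \<le> cut_form \<epsilon> F x S"
  shows "x \<in> K"
  using \<open>finite F\<close> ends vecs assms(7,8)
proof (induction F arbitrary: x rule: finite_induct)
  case empty
  \<comment> \<open>Without edges, the form at a singleton is the coordinate itself.\<close>
  have nonneg: "0 \<le> coord x (Inl i)" if "i \<in> V" for i
    using empty.prems(4)[of "{i}"] that by (simp add: cut_form_def)
  have "x = lin_ext unit_vec x"
    by (simp add: lin_ext_unit_vec_id)
  also have "\<dots> = (\<Sum>a\<in>Inl ` V. coord x a *\<^sub>R unit_vec a)"
    using V empty.prems(3) by (intro lin_ext_eq_sum) auto
  also have "\<dots> \<in> K"
  proof -
    have "(\<Sum>a\<in>X. coord x a *\<^sub>R unit_vec a) \<in> K" if "X \<subseteq> Inl ` V" "finite X" for X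
      using that(2,1)
    proof (induction X rule: finite_induct)
      case empty
      then show ?case using K by (simp add: convex_cone_contains_0)
    next
      case (insert a X)
      then show ?case
        using nonneg unit by (auto intro!: convex_cone_add[OF K] convex_cone_scaleR[OF K])
    qed
    then show ?thesis using V by simp
  qed
  finally show ?case .
next
  case (insert f F)
  obtain i j where f: "\<epsilon> f = Upair i j"
    by (cases "\<epsilon> f")
  have ij: "i \<in> V" "j \<in> V"
    using insert.prems(1)[of f] f by auto
  define r where "r = coord x (Inr f)"
  have fin: "finite S" if "S \<subseteq> V" for S
    using that V finite_subset by blast
  have form: "cut_form \<epsilon> (insert f F) x S = cut_form \<epsilon> F x S + cut_weight r (Upair i j) S" for S
    using insert.hyps by (simp add: cut_form_def r_def f)
  \<comment> \<open>Subtracting a vector \<open>y\<close> that uses up the whole coordinate at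
    \<open>f\<close> leaves a problem for \<open>F\<close>, provided that the vertex sums of
    \<open>y\<close> respect the forms over \<open>F\<close>.\<close>
  have step: "x - y \<in> K" if y_supp: "supp y \<subseteq> {Inl i, Inl j, Inr f}" and y_f: "coord y (Inr f) = r"
    and y_le: "\<And>S. S \<subseteq> V \<Longrightarrow> (\<Sum>k\<in>S. coord y (Inl k)) \<le> cut_form \<epsilon> F x S" for y
  proof (rule insert.IH)
    have "a \<in> V <+> F" if a: "a \<in> supp (x - y)" for a
    proof -
      have "a \<noteq> Inr f"
        using a y_f by (auto simp: in_keys_iff lookup_minus r_def)
      moreover have "a \<in> supp x \<or> a \<in> supp y"
        using a by (auto simp: in_keys_iff lookup_minus)
      ultimately show ?thesis
        using y_supp insert.prems(3) ij by auto
    qed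
    then show "supp (x - y) \<subseteq> V <+> F" by blast
    have "coord y (Inr f') = 0" if "f' \<in> F" for f'
      using y_supp that insert.hyps(2) by (auto simp: in_keys_iff)
    then have "cut_form \<epsilon> F (x - y) S = cut_form \<epsilon> F x S - (\<Sum>k\<in>S. coord y (Inl k))" for S
      by (simp add: cut_form_def lookup_minus sum_subtractf)
    then show "0 \<le> cut_form \<epsilon> F (x - y) S" if "S \<subseteq> V" for S
      using y_le[OF that] by simp
  qed (use insert.prems in auto)
  have "\<exists>y\<in>K. x - y \<in> K"
  proof (cases "r < 0")
    case True
    \<comment> \<open>This multiple of the generator with edge coefficient -1 has vertex sum
      \<open>- cut_weight r (Upair i j) S\<close> over \<open>S\<close>, so the required bound is
      the hypothesis for \<open>insert f F\<close>.\<close>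
    define y :: "'v + 'e \<Rightarrow>\<^sub>0 real" where
      "y = (- r) *\<^sub>R (unit_vec (Inl i) + unit_vec (Inl j) - unit_vec (Inr f))"
    have "y \<in> K"
      unfolding y_def using insert.prems(2)[OF _ f] True
      by (intro convex_cone_scaleR[OF K]) (auto simp: edge_vectors_def)
    moreover have "x - y \<in> K"
    proof (rule step)
      fix S assume S: "S \<subseteq> V"
      have "(\<Sum>k\<in>S. coord y (Inl k)) = (- r) * (of_bool (i \<in> S) + of_bool (j \<in> S))"
        unfolding y_def coord_scaleR sum_distrib_left[symmetric]
        by (simp add: sum_coord_unit_vec[OF fin[OF S]] lookup_add lookup_minus sum.distrib sum_subtractf)
      then show "(\<Sum>k\<in>S. coord y (Inl k)) \<le> cut_form \<epsilon> F x S"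
        using insert.prems(4)[OF S] True unfolding form
        by (auto simp: cut_weight_def split: if_splits)
    qed (auto simp: y_def in_keys_iff coord_simps split: if_splits)
    ultimately show ?thesis by blast
  next
    case False
    \<comment> \<open>Sets containing only \<open>i\<close> bound the share \<open>q\<close> from
      above, sets containing only \<open>j\<close> from below. For a loop no set separates the ends,
      and only \<open>- r \<le> q \<le> r\<close> remains.\<close>
    have "\<exists>q. - r \<le> q \<and> q \<le> r \<and>
      (\<forall>S\<subseteq>V. i \<in> S \<and> j \<notin> S \<longrightarrow> q \<le> cut_form \<epsilon> F x S) \<and>
      (\<forall>T\<subseteq>V. j \<in> T \<and> i \<notin> T \<longrightarrow> - q \<le> cut_form \<epsilon> F x T)"
    proof -
      \<comment> \<open>All upper bounds on \<open>q\<close>; their minimum will be the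
        witness.\<close>
      define Q where "Q = insert r (cut_form \<epsilon> F x ` {S. S \<subseteq> V \<and> i \<in> S \<and> j \<notin> S})"
      have "finite {S. S \<subseteq> V \<and> i \<in> S \<and> j \<notin> S}"
        using V by (rule finite_subset[rotated, OF finite_Pow_iff[THEN iffD2]]) auto
      then have Q: "finite Q" "Q \<noteq> {}"
        by (auto simp: Q_def)
      have bound: "- r \<le> cut_form \<epsilon> F x S" if "S \<subseteq> V" "i \<in> S \<longleftrightarrow> j \<notin> S" for S
        using insert.prems(4)[OF that(1)] that False unfolding form
        by (auto simp: cut_weight_def split: if_splits)
      have cross: "0 \<le> cut_form \<epsilon> F x S + cut_form \<epsilon> F x T"
        if "S \<subseteq> V" "i \<in> S" "j \<notin> S" "T \<subseteq> V" "j \<in> T" "i \<notin> T" for S T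
      proof -
        \<comment> \<open>The intersection contains neither end and the union both, so for
          \<open>r \<ge> 0\<close> the edge \<open>f\<close> has weight 0 on either set.\<close>
        have "0 \<le> cut_form \<epsilon> F x (S \<inter> T)" "0 \<le> cut_form \<epsilon> F x (S \<union> T)"
          using insert.prems(4)[of "S \<inter> T"] insert.prems(4)[of "S \<union> T"] that False
          unfolding form by (auto simp: cut_weight_def split: if_splits)
        then show ?thesis
          using cut_form_submodular[of S T \<epsilon> F x] that fin by auto
      qed
      have "- r \<le> Min Q"
        using Q False bound by (auto simp: Q_def)
      moreover have "Min Q \<le> r" "\<forall>S\<subseteq>V. i \<in> S \<and> j \<notin> S \<longrightarrow> Min Q \<le> cut_form \<epsilon> F x S"
        using Q(1) by (auto simp: Q_def intro!: Min_le)
      moreover have "\<forall>T\<subseteq>V. j \<in> T \<and> i \<notin> T \<longrightarrow> - Min Q \<le> cut_form \<epsilon> F x T"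
      proof (intro allI impI)
        fix T assume T: "T \<subseteq> V" "j \<in> T \<and> i \<notin> T"
        have "- cut_form \<epsilon> F x T \<le> r"
          using bound[of T] T by auto
        moreover have "- cut_form \<epsilon> F x T \<le> cut_form \<epsilon> F x S" if "S \<subseteq> V" "i \<in> S" "j \<notin> S" for S
          using cross[OF that, of T] T by simp
        ultimately have "- cut_form \<epsilon> F x T \<le> Min Q"
          using Q(1) by (auto simp: Q_def)
        then show "- Min Q \<le> cut_form \<epsilon> F x T"
          by linarith
      qed
      ultimately show ?thesis
        by (intro exI[of _ "Min Q"] conjI)
    qed
    then obtain q where q: "- r \<le> q" "q \<le> r"
      "\<forall>S\<subseteq>V. i \<in> S \<and> j \<notin> S \<longrightarrow> q \<le> cut_form \<epsilon> F x S"
      "\<forall>T\<subseteq>V. j \<in> T \<and> i \<notin> T \<longrightarrow> - q \<le> cut_form \<epsilon> F x T"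
      by (elim exE conjE)
    \<comment> \<open>The coefficients are nonnegative because \<open>- r \<le> q \<le> r\<close>;
      the combination has \<open>q\<close> at \<open>i\<close>, \<open>- q\<close> at
      \<open>j\<close> and \<open>r\<close> at \<open>f\<close>.\<close>
    define y :: "'v + 'e \<Rightarrow>\<^sub>0 real" where
      "y = ((r + q) / 2) *\<^sub>R (unit_vec (Inl i) - unit_vec (Inl j) + unit_vec (Inr f)) +
           ((r - q) / 2) *\<^sub>R (- unit_vec (Inl i) + unit_vec (Inl j) + unit_vec (Inr f))"
    have y_eq: "y = q *\<^sub>R unit_vec (Inl i) - q *\<^sub>R unit_vec (Inl j) + r *\<^sub>R unit_vec (Inr f)"
      by (rule poly_mapping_eqI) (auto simp: y_def coord_simps field_simps)
    have "y \<in> K"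
      unfolding y_def using insert.prems(2)[OF _ f] q(1,2)
      by (intro convex_cone_add[OF K convex_cone_scaleR[OF K] convex_cone_scaleR[OF K]])
        (auto simp: edge_vectors_def)
    moreover have "x - y \<in> K"
    proof (rule step)
      fix S assume S: "S \<subseteq> V"
      have *: "0 \<le> cut_form \<epsilon> F x S" if "i \<in> S \<longleftrightarrow> j \<in> S"
        using insert.prems(4)[OF S] that False unfolding form
        by (auto simp: cut_weight_def split: if_splits)
      have "(\<Sum>k\<in>S. coord y (Inl k)) = q * of_bool (i \<in> S) - q * of_bool (j \<in> S)"
        by (simp add: sum_coord_unit_vec[OF fin[OF S]] y_eq lookup_add lookup_minus sum.distrib sum_subtractf flip: sum_distrib_left)
      then show "(\<Sum>k\<in>S. coord y (Inl k)) \<le> cut_form \<epsilon> F x S"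
        using q(3)[rule_format, OF S] q(4)[rule_format, OF S] * by (cases "i \<in> S"; cases "j \<in> S") auto
    qed (auto simp: y_eq in_keys_iff coord_simps split: if_splits)
    ultimately show ?thesis by blast
  qed
  then show ?case
    using convex_cone_add[OF K] by (metis add.commute diff_add_cancel)
qed

section \<open>The cosmological cone as the solution set of the cut inequalities\<close>

definition cosmological_generators :: "('v, 'e) mgraph \<Rightarrow> ('v + 'e \<Rightarrow>\<^sub>0 real) set" where
  "cosmological_generators G = (\<Union>f\<in>edges G. \<Union>(i, j)\<in>{(i, j). ends G f = Upair i j}. edge_vectors i j f)"

definition cosmological_cone :: "('v, 'e) mgraph \<Rightarrow> ('v + 'e \<Rightarrow>\<^sub>0 real) set" where
  "cosmological_cone G = convex_cone hull cosmological_generators G"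

lemma cosmological_polytope_eq: "cosmological_polytope G = convex hull cosmological_generators G"
  by (simp add: cosmological_polytope_def cosmological_generators_def edge_vectors_def)

lemma edge_vectors_subset_generators:
  "f \<in> edges G \<Longrightarrow> ends G f = Upair i j \<Longrightarrow> edge_vectors i j f \<subseteq> cosmological_generators G"
  by (auto simp: cosmological_generators_def)

lemma cosmological_generatorsE:
  assumes "x \<in> cosmological_generators G"
  obtains f i j where "f \<in> edges G" "ends G f = Upair i j" "x \<in> edge_vectors i j f"
  using assms by (auto simp: cosmological_generators_def)

lemma generators_subset_cone: "cosmological_generators G \<subseteq> cosmological_cone G"
  by (simp add: cosmological_cone_def hull_subset)

lemma convex_cone_cosmological_cone: "convex_cone (cosmological_cone G)"
  by (simp add: cosmological_cone_def convex_cone_convex_cone_hull)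

text \<open>As \<open>u\<close> is not isolated, it lies on an edge; half the sum of two generators
  of that edge is the unit vector.\<close>

lemma unit_vec_mem_cosmological_cone:
  assumes "multigraph G" "u \<in> verts G"
  shows "unit_vec (Inl u) \<in> cosmological_cone G"
proof -
  obtain f where f: "f \<in> edges G" "u \<in> set_uprod (ends G f)"
    using assms by (auto simp: multigraph_def)
  then obtain j where j: "ends G f = Upair u j"
    by (cases "ends G f") auto
  have "unit_vec (Inl u) + unit_vec (Inl j) - unit_vec (Inr f) \<in> cosmological_cone G"
    "unit_vec (Inl u) - unit_vec (Inl j) + unit_vec (Inr f) \<in> cosmological_cone G"
    using edge_vectors_subset_generators[OF f(1) j] generators_subset_cone[of G]
    by (auto simp: edge_vectors_def)
  then have "(1/2) *\<^sub>R ((unit_vec (Inl u) + unit_vec (Inl j) - unit_vec (Inr f)) +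
      (unit_vec (Inl u) - unit_vec (Inl j) + unit_vec (Inr f))) \<in> cosmological_cone G"
    using convex_cone_cosmological_cone
    by (intro convex_cone_scaleR[of "cosmological_cone G"] convex_cone_add[of "cosmological_cone G" "_ - _" "_ + _"]) auto
  also have "(1/2) *\<^sub>R ((unit_vec (Inl u) + unit_vec (Inl j) - unit_vec (Inr f)) +
      (unit_vec (Inl u) - unit_vec (Inl j) + unit_vec (Inr f))) = unit_vec (Inl u)"
    by (simp flip: scaleR_2)
  finally show ?thesis .
qed

text \<open>The form is not linear in \<open>x\<close>, but \<open>cut_weight\<close> is concave and
  positively homogeneous in the edge coordinate. So the form is superadditive, which
  suffices.\<close>

lemma convex_cone_cut_form:
  "convex_cone {x. supp x \<subseteq> A \<and> (\<forall>S\<subseteq>V. 0 \<le> cut_form \<epsilon> F x S)}"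
  unfolding convex_cone_iff
proof (intro conjI ballI allI impI CollectI)
  fix x y S assume xy: "x \<in> {x. supp x \<subseteq> A \<and> (\<forall>S\<subseteq>V. 0 \<le> cut_form \<epsilon> F x S)}"
    "y \<in> {x. supp x \<subseteq> A \<and> (\<forall>S\<subseteq>V. 0 \<le> cut_form \<epsilon> F x S)}"
  show "supp (x + y) \<subseteq> A"
    using xy keys_add[of x y] by blast
  assume "S \<subseteq> V"
  then have "0 \<le> cut_form \<epsilon> F x S" "0 \<le> cut_form \<epsilon> F y S"
    using xy by simp_all
  moreover have "cut_form \<epsilon> F x S + cut_form \<epsilon> F y S \<le> cut_form \<epsilon> F (x + y) S"
  proof -
    have "(\<Sum>f\<in>F. cut_weight (coord x (Inr f)) (\<epsilon> f) S) + (\<Sum>f\<in>F. cut_weight (coord y (Inr f)) (\<epsilon> f) S)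
        \<le> (\<Sum>f\<in>F. cut_weight (coord (x + y) (Inr f)) (\<epsilon> f) S)"
      unfolding lookup_add by (simp only: sum.distrib[symmetric]) (intro sum_mono cut_weight_add)
    then show ?thesis
      by (simp add: cut_form_def lookup_add sum.distrib)
  qed
  ultimately show "0 \<le> cut_form \<epsilon> F (x + y) S"
    by linarith
next
  fix x S and c :: real
  assume x: "x \<in> {x. supp x \<subseteq> A \<and> (\<forall>S\<subseteq>V. 0 \<le> cut_form \<epsilon> F x S)}" and c: "0 \<le> c"
  show "supp (c *\<^sub>R x) \<subseteq> A"
    using x by (auto simp: in_keys_iff)
  assume "S \<subseteq> V"
  moreover have "cut_form \<epsilon> F (c *\<^sub>R x) S = c * cut_form \<epsilon> F x S"
    using c by (simp add: cut_form_def cut_weight_scale distrib_left sum_distrib_left)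
  ultimately show "0 \<le> cut_form \<epsilon> F (c *\<^sub>R x) S"
    using x c by simp
qed (auto simp: cut_form_def)

text \<open>The inequalities define a convex cone containing the generators, hence are necessary;
  \<open>mem_cone_if_cut_form_nonneg\<close> shows that they suffice.\<close>

lemma cosmological_cone_eq:
  assumes G: "multigraph G"
  shows "cosmological_cone G =
    {x. supp x \<subseteq> verts G <+> edges G \<and> (\<forall>S\<subseteq>verts G. 0 \<le> cut_form (ends G) (edges G) x S)}"
    (is "_ = ?R")
proof
  have fin: "finite (verts G)" "finite (edges G)"
    and ends: "\<And>f. f \<in> edges G \<Longrightarrow> set_uprod (ends G f) \<subseteq> verts G"
    using G by (auto simp: multigraph_def)
  show "cosmological_cone G \<subseteq> ?R"
    unfolding cosmological_cone_def
  proof (rule hull_minimal)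
    show "cosmological_generators G \<subseteq> ?R"
    proof
      fix x assume "x \<in> cosmological_generators G"
      then obtain f i j where f: "f \<in> edges G" "ends G f = Upair i j" and x: "x \<in> edge_vectors i j f"
        by (rule cosmological_generatorsE)
      have ij: "i \<in> verts G" "j \<in> verts G"
        using ends[OF f(1)] f(2) by auto
      have "supp x \<subseteq> {Inl i, Inl j, Inr f}"
        using x by (auto simp: edge_vectors_def in_keys_iff coord_simps split: if_splits)
      then have "supp x \<subseteq> verts G <+> edges G"
        using ij f by auto
      moreover have "0 \<le> cut_form (ends G) (edges G) x S" if "S \<subseteq> verts G" for S
      proof -
        have S: "finite S"
          using that fin finite_subset by blast
        have "coord x (Inr f') = 0" if "f' \<noteq> f" for f'
          using \<open>supp x \<subseteq> {_, _, _}\<close> that by (auto simp: in_keys_iff)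
        then have "(\<Sum>f\<in>edges G. cut_weight (coord x (Inr f)) (ends G f) S) =
            (\<Sum>f\<in>{f}. cut_weight (coord x (Inr f)) (ends G f) S)"
          using f(1) fin(2) by (intro sum.mono_neutral_right) auto
        then have "cut_form (ends G) (edges G) x S =
            (\<Sum>k\<in>S. coord x (Inl k)) + cut_weight (coord x (Inr f)) (Upair i j) S"
          by (simp add: cut_form_def f(2))
        then show ?thesis
          using x
          by (auto simp: sum_coord_unit_vec[OF S] edge_vectors_def lookup_add lookup_minus sum.distrib sum_subtractf
              sum_negf cut_weight_def) (auto simp: coord_unit_vec)
      qed
      ultimately show "x \<in> ?R" by blast
    qed
  qed (rule convex_cone_cut_form)
  show "?R \<subseteq> cosmological_cone G"
  proof
    fix x assume "x \<in> ?R"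
    then have x: "supp x \<subseteq> verts G <+> edges G"
      "\<And>S. S \<subseteq> verts G \<Longrightarrow> 0 \<le> cut_form (ends G) (edges G) x S"
      by auto
    have vecs: "edge_vectors i j f \<subseteq> cosmological_cone G"
      if "f \<in> edges G" "ends G f = Upair i j" for f i j
      using edge_vectors_subset_generators[OF that] generators_subset_cone by (rule order_trans)
    show "x \<in> cosmological_cone G"
      by (rule mem_cone_if_cut_form_nonneg[OF convex_cone_cosmological_cone fin
            unit_vec_mem_cosmological_cone[OF G] ends vecs x])
  qed
qed

text \<open>The coordinate at \<open>u\<close> enters each \<open>cut_form\<close> with coefficient 0 or 1.\<close>

lemma cosmological_cone_floor:
  assumes G: "multigraph G" and u: "u \<in> verts G" and x: "x \<in> cosmological_cone G"
    and int: "\<And>a. a \<noteq> Inl u \<Longrightarrow> coord x a \<in> \<int>"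
  shows "x - frac (coord x (Inl u)) *\<^sub>R unit_vec (Inl u) \<in> cosmological_cone G"
proof -
  define y where "y = x - frac (coord x (Inl u)) *\<^sub>R unit_vec (Inl u)"
  have y: "coord y a = (if a = Inl u then of_int \<lfloor>coord x (Inl u)\<rfloor> else coord x a)" for a
    by (simp add: y_def coord_simps frac_def)
  have "supp y \<subseteq> insert (Inl u) (supp x)"
    by (auto simp: y in_keys_iff split: if_splits)
  then have "supp y \<subseteq> verts G <+> edges G"
    using x u unfolding cosmological_cone_eq[OF G] by blast
  moreover have "0 \<le> cut_form (ends G) (edges G) y S" if S: "S \<subseteq> verts G" for S
  proof -
    have nonneg: "0 \<le> cut_form (ends G) (edges G) x S"
      using x S unfolding cosmological_cone_eq[OF G] by blast
    show ?thesis
    proof (cases "u \<in> S")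
      case False
      then have "cut_form (ends G) (edges G) y S = cut_form (ends G) (edges G) x S"
        by (auto simp: cut_form_def y intro!: sum.cong)
      with nonneg show ?thesis by simp
    next
      case True
      have finS: "finite S"
        using G S finite_subset by (auto simp: multigraph_def)
      \<comment> \<open>All of the form except the coordinate at \<open>u\<close>. It is an integer,
        so \<open>coord x (Inl u) \<ge> - m\<close> survives rounding down.\<close>
      define m where "m = (\<Sum>i\<in>S - {u}. coord x (Inl i)) +
        (\<Sum>f\<in>edges G. cut_weight (coord x (Inr f)) (ends G f) S)"
      have "m \<in> \<int>"
        unfolding m_def using int by (auto intro!: Ints_add Ints_sum cut_weight_Ints)
      have "cut_form (ends G) (edges G) x S = coord x (Inl u) + m"
        by (simp add: cut_form_def m_def sum.remove[OF finS True])
      moreover have "cut_form (ends G) (edges G) y S = of_int \<lfloor>coord x (Inl u)\<rfloor> + m"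
        by (simp add: cut_form_def m_def sum.remove[OF finS True] y)
      ultimately show ?thesis
        using nonneg \<open>m \<in> \<int>\<close> by (auto elim!: Ints_cases simp flip: of_int_add) linarith
    qed
  qed
  ultimately show ?thesis
    unfolding cosmological_cone_eq[OF G] y_def by blast
qed

section \<open>Ehrhart series and dimension of cosmological polytopes\<close>

text \<open>Generators have coordinate sum 1 and entries of absolute value at most 2, where 2 occurs
  for a loop; the bound passes to nonnegative combinations. It gives both finiteness at each height
  and nonnegative heights.\<close>

lemma cosmological_cone_coord_bound:
  fixes G :: "('v, 'e) mgraph"
  assumes "x \<in> cosmological_cone G"
  shows "\<bar>coord x a\<bar> \<le> 2 * coord_sum x"
proof -
  have "convex_cone {x :: 'v + 'e \<Rightarrow>\<^sub>0 real. \<forall>a. \<bar>coord x a\<bar> \<le> 2 * coord_sum x}"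
    unfolding convex_cone_iff
  proof (intro conjI ballI allI impI CollectI)
    fix x y :: "'v + 'e \<Rightarrow>\<^sub>0 real" and a
    assume "x \<in> {x. \<forall>a. \<bar>coord x a\<bar> \<le> 2 * coord_sum x}" "y \<in> {x. \<forall>a. \<bar>coord x a\<bar> \<le> 2 * coord_sum x}"
    then have "\<bar>coord x a\<bar> \<le> 2 * coord_sum x" "\<bar>coord y a\<bar> \<le> 2 * coord_sum y"
      by simp_all
    then show "\<bar>coord (x + y) a\<bar> \<le> 2 * coord_sum (x + y)"
      by (simp add: lookup_add)
  next
    fix x :: "'v + 'e \<Rightarrow>\<^sub>0 real" and c :: real and a
    assume "x \<in> {x. \<forall>a. \<bar>coord x a\<bar> \<le> 2 * coord_sum x}" and c: "0 \<le> c"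
    then have "\<bar>coord x a\<bar> \<le> 2 * coord_sum x"
      by simp
    from mult_left_mono[OF this c] c show "\<bar>coord (c *\<^sub>R x) a\<bar> \<le> 2 * coord_sum (c *\<^sub>R x)"
      by (simp add: abs_mult mult_ac)
  qed simp
  moreover have "cosmological_generators G \<subseteq> {x. \<forall>a. \<bar>coord x a\<bar> \<le> 2 * coord_sum x}"
    by (force elim!: cosmological_generatorsE simp: edge_vectors_def coord_simps)
  ultimately have "cosmological_cone G \<subseteq> {x. \<forall>a. \<bar>coord x a\<bar> \<le> 2 * coord_sum x}"
    unfolding cosmological_cone_def by (intro hull_minimal)
  with assms show ?thesis by blast
qed

lemma finite_integral_bounded:
  assumes "finite A"
  shows "finite {x. supp x \<subseteq> A \<and> (\<forall>a. coord x a \<in> \<int>) \<and> (\<forall>a. \<bar>coord x a\<bar> \<le> M)}" (is "finite ?X")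
proof (rule finite_imageD)
  let ?B = "{k \<in> \<int>. \<bar>k\<bar> \<le> M}"
  have "finite {f. \<forall>a. (a \<in> A \<longrightarrow> f a \<in> ?B) \<and> (a \<notin> A \<longrightarrow> f a = 0)}"
    using assms finite_abs_int_segment by (rule finite_set_of_finite_funs)
  moreover have "coord ` ?X \<subseteq> {f. \<forall>a. (a \<in> A \<longrightarrow> f a \<in> ?B) \<and> (a \<notin> A \<longrightarrow> f a = 0)}"
    by (auto simp: in_keys_iff)
  ultimately show "finite (coord ` ?X)"
    by (rule finite_subset[rotated])
  show "inj_on coord ?X"
    by (auto intro!: inj_onI poly_mapping_eqI)
qed

lemma floor_cone_cosmological_cone:
  assumes G: "multigraph G" and u: "u \<in> verts G"
  shows "floor_cone (cosmological_cone G) (Inl u) (verts G <+> edges G)"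
proof
  show supp: "supp x \<subseteq> verts G <+> edges G" if "x \<in> cosmological_cone G" for x
    using that unfolding cosmological_cone_eq[OF G] by blast
  show "0 \<le> coord_sum x" if "x \<in> cosmological_cone G" for x
    using cosmological_cone_coord_bound[OF that, of "Inl u"] abs_ge_zero[of "coord x (Inl u)"]
    by linarith
  show "finite (integral_points (cosmological_cone G) t)" for t
  proof (rule finite_subset)
    show "integral_points (cosmological_cone G) t \<subseteq> {x. supp x \<subseteq> verts G <+> edges G \<and>
        (\<forall>a. coord x a \<in> \<int>) \<and> (\<forall>a. \<bar>coord x a\<bar> \<le> 2 * real t)}"
    proof
      fix x assume x: "x \<in> integral_points (cosmological_cone G) t"
      then have "x \<in> cosmological_cone G" "coord_sum x = real t"
        by (auto simp: integral_points_def)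
      with x supp cosmological_cone_coord_bound[of x G] show "x \<in> {x. supp x \<subseteq> verts G <+> edges G \<and>
          (\<forall>a. coord x a \<in> \<int>) \<and> (\<forall>a. \<bar>coord x a\<bar> \<le> 2 * real t)}"
        by (auto simp: integral_points_def)
    qed
  qed (use G in \<open>auto intro!: finite_integral_bounded simp: multigraph_def\<close>)
  show "x - frac (coord x (Inl u)) *\<^sub>R unit_vec (Inl u) \<in> cosmological_cone G"
    if "x \<in> cosmological_cone G" "\<And>a. a \<noteq> Inl u \<Longrightarrow> coord x a \<in> \<int>" for x
    using cosmological_cone_floor[OF G u that] .
qed (use convex_cone_cosmological_cone unit_vec_mem_cosmological_cone[OF G u] in auto)

lemma coord_sum_cosmological_polytope:
  fixes G :: "('v, 'e) mgraph"
  assumes "x \<in> cosmological_polytope G"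
  shows "coord_sum x = 1"
proof -
  have "convex {x :: 'v + 'e \<Rightarrow>\<^sub>0 real. coord_sum x = 1}"
    by (auto simp: convex_def)
  moreover have "cosmological_generators G \<subseteq> {x. coord_sum x = 1}"
    by (auto elim!: cosmological_generatorsE simp: edge_vectors_def)
  ultimately have "cosmological_polytope G \<subseteq> {x. coord_sum x = 1}"
    unfolding cosmological_polytope_eq by (intro hull_minimal)
  with assms show ?thesis by blast
qed

text \<open>A point of the cone is a nonnegative multiple of a point of the polytope, and since the
  polytope lies at height 1, the multiple is the height.\<close>

lemma lattice_points_cosmological_polytope:
  assumes "cosmological_generators G \<noteq> {}"
  shows "lattice_points ((*\<^sub>R) (real t) ` cosmological_polytope G) =
    integral_points (cosmological_cone G) t"
proof -
  have "{x \<in> cosmological_cone G. coord_sum x = real t} = (*\<^sub>R) (real t) ` cosmological_polytope G"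
    unfolding cosmological_cone_def convex_cone_hull_convex_hull_nonempty[OF assms]
      cosmological_polytope_eq[symmetric]
    using coord_sum_cosmological_polytope by fastforce
  then show ?thesis
    by (auto simp: lattice_points_def integral_points_def)
qed

text \<open>The constant term 1, prescribed in \<open>ehrhart_series\<close>, agrees with the count
  at height 0, where the cone has only the origin.\<close>

lemma ehrhart_series_cosmological_polytope:
  assumes "cosmological_generators G \<noteq> {}"
  shows "ehrhart_series (cosmological_polytope G) =
    Abs_fps (\<lambda>t. int (card (integral_points (cosmological_cone G) t)))"
proof (rule fps_ext)
  have "cosmological_polytope G \<noteq> {}"
    using assms by (simp add: cosmological_polytope_eq)
  then have zero: "(*\<^sub>R) (real 0) ` cosmological_polytope G = {0}"
    by auto
  have "lattice_points ((*\<^sub>R) (real 0) ` cosmological_polytope G) = {0}"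
    unfolding zero by (auto simp: lattice_points_def)
  then have "integral_points (cosmological_cone G) 0 = {0}"
    unfolding lattice_points_cosmological_polytope[OF assms] .
  then show "fps_nth (ehrhart_series (cosmological_polytope G)) t =
      fps_nth (Abs_fps (\<lambda>t. int (card (integral_points (cosmological_cone G) t)))) t" for t
    by (cases "t = 0")
      (simp_all add: ehrhart_series_def lattice_points_cosmological_polytope[OF assms])
qed

section \<open>Dimension of the polytope\<close>

lemma inj_on_unit_vec: "inj_on unit_vec A"
  by (metis inj_onI singleton_inject supp_unit_vec)

lemma independent_unit_vecs:
  assumes "finite A"
  shows "independent (unit_vec ` A)"
proof (rule independent_if_scalars_zero)
  fix f :: "('a \<Rightarrow>\<^sub>0 real) \<Rightarrow> real" and x
  assume sum: "(\<Sum>x\<in>unit_vec ` A. f x *\<^sub>R x) = 0" and "x \<in> unit_vec ` A"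
  then obtain a where a: "a \<in> A" "x = unit_vec a" by blast
  have "0 = coord (\<Sum>b\<in>A. f (unit_vec b) *\<^sub>R unit_vec b) a"
    using sum by (simp add: sum.reindex inj_on_unit_vec)
  also have "\<dots> = f x"
    using a assms by (simp add: lookup_sum coord_unit_vec if_distrib cong: if_cong)
  finally show "f x = 0" by simp
qed (use assms in simp)

text \<open>\<open>P\<close> lies in the hyperplane of coordinate sum 1, which misses the origin. So
  a basis of its direction space, where the coordinate sum vanishes, becomes a basis of
  \<open>span P\<close> when one point of \<open>P\<close> is added.\<close>

lemma polytope_dim_Suc:
  assumes A: "finite A" and span: "span P = span (unit_vec ` A)"
    and "P \<noteq> {}" and sum: "\<And>x. x \<in> P \<Longrightarrow> coord_sum x = 1"
  shows "polytope_dim P + 1 = card A"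
proof -
  define D where "D = {x - y | x y. x \<in> P \<and> y \<in> P}"
  obtain p where p: "p \<in> P" using \<open>P \<noteq> {}\<close> by blast
  obtain B where B: "B \<subseteq> D" "independent B" "D \<subseteq> span B" "card B = dim D"
    by (rule basis_exists)
  have D_P: "D \<subseteq> span P"
    by (auto simp: D_def intro: span_diff span_base)
  have "B \<subseteq> span (unit_vec ` A)"
    using B(1) D_P span by blast
  then have "finite B"
    using independent_span_bound[OF _ B(2)] A by blast
  have "subspace {x :: 'a \<Rightarrow>\<^sub>0 real. coord_sum x = 0}"
    by (auto simp: subspace_def)
  moreover have "B \<subseteq> {x. coord_sum x = 0}"
    using B(1) sum by (auto simp: D_def)
  ultimately have "span B \<subseteq> {x. coord_sum x = 0}"
    by (intro span_minimal)
  then have p_notin: "p \<notin> span B"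
    using sum[OF p] by auto
  have "span (insert p B) = span P"
  proof (rule span_eq[THEN iffD2], intro conjI subsetI)
    fix x assume "x \<in> insert p B"
    then show "x \<in> span P"
      using p B(1) D_P by (auto intro: span_base)
  next
    fix x assume "x \<in> P"
    then have "x - p \<in> span B"
      using p B(3) by (auto simp: D_def)
    then have "x - p \<in> span (insert p B)"
      using span_mono[OF subset_insertI] by blast
    then have "(x - p) + p \<in> span (insert p B)"
      by (rule span_add) (simp add: span_base)
    then show "x \<in> span (insert p B)" by simp
  qed
  moreover have "independent (insert p B)"
    using p_notin B(2) by (rule independent_insertI)
  ultimately have "dim (unit_vec ` A) = card (insert p B)"
    by (intro dim_eq_card) (simp_all add: span)
  moreover have "dim (unit_vec ` A) = card A"
    using dim_eq_card_independent[OF independent_unit_vecs[OF A]]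
    by (simp add: card_image inj_on_unit_vec)
  moreover have "card (insert p B) = dim D + 1"
    using \<open>finite B\<close> p_notin B(4) by (metis Suc_eq_plus1 card_insert_disjoint span_base)
  ultimately show ?thesis
    by (simp add: polytope_dim_def D_def)
qed

lemma span_cosmological_polytope:
  assumes G: "multigraph G"
  shows "span (cosmological_polytope G) = span (unit_vec ` (verts G <+> edges G))"
proof (rule span_eq[THEN iffD2], intro conjI)
  have gens: "cosmological_generators G \<subseteq> span (unit_vec ` (verts G <+> edges G))"
  proof
    fix x assume "x \<in> cosmological_generators G"
    then obtain f i j where f: "f \<in> edges G" "ends G f = Upair i j" and x: "x \<in> edge_vectors i j f"
      by (rule cosmological_generatorsE)
    have "i \<in> verts G" "j \<in> verts G"
      using G f by (force simp: multigraph_def)+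
    then have "unit_vec (Inl i) \<in> span (unit_vec ` (verts G <+> edges G))"
      "unit_vec (Inl j) \<in> span (unit_vec ` (verts G <+> edges G))"
      "unit_vec (Inr f) \<in> span (unit_vec ` (verts G <+> edges G))"
      using f(1) by (auto intro!: span_base)
    then show "x \<in> span (unit_vec ` (verts G <+> edges G))"
      using x by (auto simp: edge_vectors_def intro: span_add span_diff span_neg)
  qed
  then show "cosmological_polytope G \<subseteq> span (unit_vec ` (verts G <+> edges G))"
    unfolding cosmological_polytope_eq
    by (rule hull_minimal) (simp add: subspace_imp_convex)
  have cone: "cosmological_cone G \<subseteq> span (cosmological_generators G)"
    unfolding cosmological_cone_def
    by (intro hull_minimal convex_cone_span span_superset)
  have P: "span (cosmological_generators G) \<subseteq> span (cosmological_polytope G)"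
    unfolding cosmological_polytope_eq by (intro span_mono hull_subset)
  show "unit_vec ` (verts G <+> edges G) \<subseteq> span (cosmological_polytope G)"
  proof safe
    fix u assume "u \<in> verts G"
    then show "unit_vec (Inl u) \<in> span (cosmological_polytope G)"
      using unit_vec_mem_cosmological_cone[OF G] cone P by blast
  next
    fix f assume f: "f \<in> edges G"
    obtain i j where ij: "ends G f = Upair i j"
      by (cases "ends G f")
    \<comment> \<open>In the sum of these two generators the vertex terms cancel, leaving twice the
      edge vector.\<close>
    have "(1/2) *\<^sub>R ((unit_vec (Inl i) - unit_vec (Inl j) + unit_vec (Inr f)) +
        (- unit_vec (Inl i) + unit_vec (Inl j) + unit_vec (Inr f))) \<in> span (cosmological_generators G)"
      using edge_vectors_subset_generators[OF f ij]
      by (intro span_scale span_add[OF span_base span_base]) (auto simp: edge_vectors_def)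
    then show "unit_vec (Inr f) \<in> span (cosmological_polytope G)"
      using P by (auto simp flip: scaleR_2)
  qed
qed

lemma cosmological_generators_nonempty:
  assumes "multigraph G" "u \<in> verts G"
  shows "cosmological_generators G \<noteq> {}"
proof -
  obtain f where "f \<in> edges G"
    using assms by (auto simp: multigraph_def)
  moreover obtain i j where "ends G f = Upair i j"
    by (cases "ends G f")
  ultimately show ?thesis
    using edge_vectors_subset_generators by (force simp: edge_vectors_def)
qed

lemma polytope_dim_cosmological_polytope:
  assumes G: "multigraph G" and u: "u \<in> verts G"
  shows "polytope_dim (cosmological_polytope G) + 1 = card (verts G) + card (edges G)"
proof -
  have fin: "finite (verts G)" "finite (edges G)"
    using G by (auto simp: multigraph_def)
  have "polytope_dim (cosmological_polytope G) + 1 = card (verts G <+> edges G)"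
    using fin span_cosmological_polytope[OF G] cosmological_generators_nonempty[OF G u]
      coord_sum_cosmological_polytope
    by (intro polytope_dim_Suc) (auto simp: cosmological_polytope_eq)
  then show ?thesis
    using fin by (simp add: card_Plus)
qed

section \<open>Cosmological polytopes of 1-sums\<close>

lemma relabel_edge_vectors:
  "relabel (map_sum g h) ` edge_vectors i j f = edge_vectors (g i) (g j) (h f)"
  by (simp add: edge_vectors_def)

lemma edge_vectors_commute:
  "edge_vectors i j f = (edge_vectors j i f :: ('v + 'e \<Rightarrow>\<^sub>0 real) set)"
proof -
  have flip: "- unit_vec (Inl k) + unit_vec (Inl l) =
      (unit_vec (Inl l) - unit_vec (Inl k) :: 'v + 'e \<Rightarrow>\<^sub>0 real)" for k l
    by simp
  show ?thesis
    unfolding edge_vectors_def flip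
    by (simp only: insert_commute add.commute[of "unit_vec (Inl i)" "unit_vec (Inl j)"])
qed

lemma UN_edge_vectors_Upair:
  "(\<Union>(i, j)\<in>{(i, j). Upair a b = Upair i j}. edge_vectors i j f) = edge_vectors a b f"
  using edge_vectors_commute[of a b f] by auto

lemma UN_edge_vectors_map_uprod:
  "(\<Union>(i, j)\<in>{(i, j). map_uprod g u = Upair i j}. edge_vectors i j (h f)) =
    relabel (map_sum g h) ` (\<Union>(i, j)\<in>{(i, j). u = Upair i j}. edge_vectors i j f)"
  by (cases u) (simp only: map_uprod_simps UN_edge_vectors_Upair relabel_edge_vectors)

lemma generators_one_sum:
  "cosmological_generators (one_sum G1 v w G2) =
     relabel (map_sum (glue v w) Inl) ` cosmological_generators G1 \<union>
     relabel (map_sum (glue v w) Inr) ` cosmological_generators G2"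
  by (simp add: cosmological_generators_def one_sum_def Plus_def UN_Un UN_edge_vectors_map_uprod
      image_UN[of _ _ "edges _"])

text \<open>Conic hulls commute with linear maps and turn unions into Minkowski sums, so the
  description of the generators carries over.\<close>

lemma cosmological_cone_one_sum:
  "cosmological_cone (one_sum G1 v w G2) =
    (\<Union>x\<in>cosmological_cone G1. \<Union>y\<in>cosmological_cone G2.
      {relabel (map_sum (glue v w) Inl) x + relabel (map_sum (glue v w) Inr) y})"
  by (simp add: cosmological_cone_def generators_one_sum convex_cone_hull_Un
      convex_cone_hull_linear_image linear_relabel)

theorem theorem3p2:
  fixes G1 :: "('v, 'e) mgraph" and G2 :: "('v, 'f) mgraph" and v w :: 'v
  assumes "multigraph G1" and "multigraph G2"
    and "verts G1 \<inter> verts G2 = {}"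
    and "v \<in> verts G1" and "w \<in> verts G2"
  shows "h_star (cosmological_polytope (one_sum G1 v w G2)) =
         h_star (cosmological_polytope G1) * h_star (cosmological_polytope G2)"
proof -
  define G where "G = one_sum G1 v w G2"
  let ?\<alpha> = "map_sum (glue v w) Inl :: 'v + 'e \<Rightarrow> 'v option + ('e + 'f)"
  let ?\<beta> = "map_sum (glue v w) Inr :: 'v + 'f \<Rightarrow> 'v option + ('e + 'f)"
  have G: "multigraph G" and None: "None \<in> verts G"
    using assms multigraph_one_sum unfolding G_def by (auto simp: one_sum_def glue_def)
  have notin: "w \<notin> verts G1" "v \<notin> verts G2"
    using assms(3-5) by auto
  interpret L: floor_cone "cosmological_cone G1" "Inl v" "verts G1 <+> edges G1"
    using assms by (intro floor_cone_cosmological_cone)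
  interpret R: floor_cone "cosmological_cone G2" "Inl w" "verts G2 <+> edges G2"
    using assms by (intro floor_cone_cosmological_cone)
  interpret S: floor_cone "cosmological_cone G" "Inl None" "verts G <+> edges G"
    using G None by (intro floor_cone_cosmological_cone)
  have \<alpha>_v: "?\<alpha> (Inl v) = Inl None"
    by (simp add: glue_def)
  interpret glued_floor_cones "cosmological_cone G1" "Inl v" "verts G1 <+> edges G1"
    "cosmological_cone G2" "Inl w" "verts G2 <+> edges G2" ?\<alpha> ?\<beta> "cosmological_cone G"
  proof
    show "inj_on ?\<alpha> (verts G1 <+> edges G1)" "inj_on ?\<beta> (verts G2 <+> edges G2)"
      using notin by (auto simp: inj_on_def glue_def split: if_splits)
    \<comment> \<open>Edges are kept apart by the sum type and old vertices by disjointness; only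
      the new vertex \<open>None\<close> is shared.\<close>
    show "?\<alpha> ` (verts G1 <+> edges G1) \<inter> ?\<beta> ` (verts G2 <+> edges G2) = {?\<alpha> (Inl v)}"
      using assms(3-5) by (force simp: glue_def split: if_splits)
    show "?\<beta> (Inl w) = ?\<alpha> (Inl v)"
      by (simp add: glue_def)
  qed (simp add: G_def cosmological_cone_one_sum)
  let ?E = "\<lambda>H. ehrhart_series (cosmological_polytope H)"
  note ehr = ehrhart_series_cosmological_polytope[OF cosmological_generators_nonempty]
  have "(1 - fps_X) * ?E G = Abs_fps (\<lambda>t. int (card (lowest_points (cosmological_cone G) (Inl None) t)))"
    unfolding ehr[OF G None] by (rule S.lowest_points_gf)
  also have "\<dots> = Abs_fps (\<lambda>t. int (card (lowest_points (cosmological_cone G1) (Inl v) t))) *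
      Abs_fps (\<lambda>t. int (card (lowest_points (cosmological_cone G2) (Inl w) t)))"
    \<comment> \<open>The count of lowest points is a convolution, that is, a Cauchy
      product.\<close>
    by (rule fps_ext) (simp add: fps_mult_nth card_lowest_points[unfolded \<alpha>_v])
  also have "\<dots> = ((1 - fps_X) * ?E G1) * ((1 - fps_X) * ?E G2)"
    unfolding ehr[OF assms(1,4)] ehr[OF assms(2,5)] L.lowest_points_gf R.lowest_points_gf ..
  finally have E: "(1 - fps_X) * ?E G = ((1 - fps_X) * ?E G1) * ((1 - fps_X) * ?E G2)" .
  have fin: "finite (verts G1)" "finite (verts G2)" "finite (edges G1)" "finite (edges G2)"
    using assms(1,2) by (auto simp: multigraph_def)
  \<comment> \<open>Gluing loses one vertex, and each dimension is one less than the number of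
    vertices and edges; so the dimensions add up exactly.\<close>
  have "verts G = insert None (Some ` ((verts G1 - {v}) \<union> (verts G2 - {w})))"
    using assms(4,5) notin by (auto simp: G_def one_sum_def glue_def image_iff)
  then have "card (verts G) = Suc (card ((verts G1 - {v}) \<union> (verts G2 - {w})))"
    using fin by (simp add: card_image)
  also have "\<dots> = Suc (card (verts G1 - {v}) + card (verts G2 - {w}))"
    using fin assms(3) by (subst card_Un_disjoint) auto
  finally have "card (verts G) + 1 = card (verts G1) + card (verts G2)"
    using fin assms(4,5) card_Suc_Diff1[of "verts G1" v] card_Suc_Diff1[of "verts G2" w] by simp
  moreover have "card (edges G) = card (edges G1) + card (edges G2)"
    using fin by (simp add: G_def one_sum_def card_Plus)
  ultimately have dim: "polytope_dim (cosmological_polytope G) =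
      polytope_dim (cosmological_polytope G1) + polytope_dim (cosmological_polytope G2)"
    using polytope_dim_cosmological_polytope[OF G None]
      polytope_dim_cosmological_polytope[OF assms(1,4)]
      polytope_dim_cosmological_polytope[OF assms(2,5)] by linarith
  \<comment> \<open>One factor \<open>1 - fps_X\<close> is split off for \<open>E\<close>, which
    returns one such factor to each summand.\<close>
  have "h_star (cosmological_polytope G) = ((1 - fps_X) * ?E G) *
      ((1 - fps_X) ^ polytope_dim (cosmological_polytope G1) * (1 - fps_X) ^ polytope_dim (cosmological_polytope G2))"
    by (simp add: h_star_def dim power_add mult_ac)
  also have "\<dots> = h_star (cosmological_polytope G1) * h_star (cosmological_polytope G2)"
    unfolding E by (simp add: h_star_def mult_ac)
  finally show ?thesis
    unfolding G_def .
qed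

end
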